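(* Let $\rho\in(0,1]$ be a real number. If $S$ is a subset of $\overline{\mathbb{Q}}\cap B(0,\rho)$ which is closed relative to $\overline{\mathbb{Q}}$, with $0\in S$, then there exist uncountably many transcendental power series $f(z)$ with integer coefficients such that \[ S_f=S,\qquad \rho_f=\rho,\qquad \delta(L_0(f))=1. \]
   Context: $B(0,r)=\{z\in\mathbb{C}:|z|<r\}$ and $\overline{\mathbb{Q}}$ is the set of algebraic numbers. For $S\subseteq\overline{\mathbb{Q}}\cap B(0,\rho)$, let $\overline{S}^{\mathrm{alg}}$ be the set of all algebraic (Galois) conjugates of elements of $S$; $S$ is closed relative to $\overline{\mathbb{Q}}$ if $\overline{S}^{\mathrm{alg}}\cap B(0,\rho)=S$. For a power series $f$, $\rho_f$ is its radius of convergence, and its exceptional set is $S_f=\{\alpha\in\overline{\mathbb{Q}}\cap B(0,\rho_f): f(\alpha)\in\overline{\mathbb{Q}}\}$. For $f(z)=\sum_{n\ge0}a_nz^n$, $L_0(f)=\{n\ge0 : a_n=0\}$, and $\delta(\mathcal{A})=\lim_{x\to\infty}\#(\mathcal{A}\cap[0,x])/x$ is the natural density (the statement includes that the limit exists). A function is transcendental if it is not algebraic over $\mathbb{C}(z)$. *)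

theory Defs
  imports "HOL-Analysis.Analysis" "HOL-Computational_Algebra.Computational_Algebra"
begin

definition is_min_poly_rat :: "rat poly \<Rightarrow> complex \<Rightarrow> bool" where
  "is_min_poly_rat p \<alpha> \<longleftrightarrow>
     lead_coeff p = 1 \<and> irreducible p \<and> poly (map_poly of_rat p) \<alpha> = 0"

definition conjugates :: "complex \<Rightarrow> complex set" where
  "conjugates \<alpha> = {\<beta>. \<exists>p. is_min_poly_rat p \<alpha> \<and> poly (map_poly of_rat p) \<beta> = 0}"

definition alg_hull :: "complex set \<Rightarrow> complex set" where
  "alg_hull S = (\<Union>\<alpha>\<in>S. conjugates \<alpha>)"

definition closed_rel_algebraic :: "real \<Rightarrow> complex set \<Rightarrow> bool" where
  "closed_rel_algebraic \<rho> S \<longleftrightarrow> alg_hull S \<inter> ball 0 \<rho> = S"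

definition exceptional_set :: "complex fps \<Rightarrow> complex set" where
  "exceptional_set f = {\<alpha> \<in> eball 0 (fps_conv_radius f). algebraic \<alpha> \<and> algebraic (eval_fps f \<alpha>)}"

definition zero_coeffs :: "complex fps \<Rightarrow> nat set" where
  "zero_coeffs f = {n. fps_nth f n = 0}"

definition has_natural_density :: "nat set \<Rightarrow> real \<Rightarrow> bool" where
  "has_natural_density A d \<longleftrightarrow>
     ((\<lambda>x::real. real (card {n \<in> A. real n \<le> x}) / x) \<longlongrightarrow> d) at_top"

text \<open>
  The field of rational functions in one variable is realised as a subfield of the field of
  formal Laurent series, in which a power series is then algebraic over it or not.
\<close>

definition rational_functions :: "complex fls set" where
  "rational_functions =
     {fps_to_fls (fps_of_poly p) / fps_to_fls (fps_of_poly q) | p q. q \<noteq> 0}"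

definition algebraic_fps :: "complex fps \<Rightarrow> bool" where
  "algebraic_fps f \<longleftrightarrow>
     (\<exists>P. P \<noteq> 0 \<and> (\<forall>i. coeff P i \<in> rational_functions) \<and> poly P (fps_to_fls f) = 0)"

definition transcendental_fps :: "complex fps \<Rightarrow> bool" where
  "transcendental_fps f \<longleftrightarrow> \<not> algebraic_fps f"

end

theory Submission
  imports Defs
begin

text \<open>
  Let \<open>Q k\<close> be the product of the minimal polynomials (with denominators cleared) of the first \<open>k\<close>
  nonzero elements of \<open>S\<close>. Every \<open>f = \<Sum>k. d k * \<lfloor>\<rho> ^ (- t k)\<rfloor> * z ^ t k * Q k\<close> with digits
  \<open>d k \<in> {1, 2}\<close> and a rapidly increasing \<open>t\<close> has radius of convergence \<open>\<rho>\<close> and consists of short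
  blocks separated by long gaps, which makes it transcendental with zero coefficients of density 1.
  At a point of \<open>S\<close> the series terminates, so the value is algebraic. At an algebraic \<open>\<alpha> \<notin> S\<close> no term
  vanishes, and if \<open>t\<close> grows fast enough the terms decay so quickly that \<open>f(\<alpha>)\<close> determines all but
  finitely many digits. Hence only countably many digit sequences give an algebraic value at some
  \<open>\<alpha> \<notin> S\<close>; all others satisfy \<open>S\<^sub>f = S\<close>.
\<close>

section \<open>Algebraic numbers\<close>

lemma poly_map_poly_of_rat_mult:
  fixes p q :: "rat poly" and x :: "'a::field_char_0"
  shows "poly (map_poly of_rat (p * q)) x = poly (map_poly of_rat p) x * poly (map_poly of_rat q) x"
proof -
  have "map_poly (of_rat :: rat \<Rightarrow> 'a) (p * q) = map_poly of_rat p * map_poly of_rat q"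
    by (rule poly_eqI) (simp add: coeff_map_poly coeff_mult of_rat_sum of_rat_mult)
  thus ?thesis by simp
qed

text \<open>The powers of \<open>x\<close> below the degree \<open>n\<close> span a rational vector
  space \<open>W\<close> that is stable under multiplication by \<open>x\<close>. It therefore
  contains every power of \<open>y = poly g x\<close>, and \<open>n + 1\<close> elements of a space
  of dimension at most \<open>n\<close> are linearly dependent. The dependency is a rational
  polynomial with root \<open>y\<close>.\<close>

lemma algebraic_poly_value:
  fixes x :: complex
  assumes "algebraic x" and g: "\<And>i. coeff g i \<in> \<int>"
  shows "algebraic (poly g x)"
proof -
  interpret rat: vector_space "\<lambda>(q::rat) (z::complex). of_rat q * z"
    by unfold_locales (auto simp: algebra_simps of_rat_add of_rat_mult)
  obtain p where p: "\<forall>i. coeff p i \<in> \<int>" "p \<noteq> 0" "poly p x = 0"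
    using assms(1) unfolding algebraic_def by blast
  define n where "n = degree p"
  define W where "W = rat.span ((\<lambda>i. x ^ i) ` {..<n})"
  have Ints_scale: "c * z \<in> W" if "c \<in> \<rat>" "z \<in> W" for c z
    using that rat.span_scale[of z] unfolding W_def by (auto elim!: Rats_cases)
  have Ints_Rats: "c \<in> \<rat>" if "c \<in> \<int>" for c :: complex
    using that by (auto elim!: Ints_cases)
  have pow_n: "x ^ n \<in> W"
  proof -
    have "0 = (\<Sum>i\<le>n. coeff p i * x ^ i)" using p(3) by (simp add: poly_altdef n_def)
    also have "\<dots> = (\<Sum>i<n. coeff p i * x ^ i) + coeff p n * x ^ n"
      by (simp add: lessThan_Suc_atMost[symmetric])
    finally have "coeff p n * x ^ n = - (\<Sum>i<n. coeff p i * x ^ i)"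
      by (simp add: eq_neg_iff_add_eq_0 add.commute)
    hence "x ^ n = (\<Sum>i<n. - (coeff p i / coeff p n) * x ^ i)"
      using p(2) by (simp add: n_def sum_negf sum_divide_distrib[symmetric] field_simps)
    also have "\<dots> \<in> W"
      unfolding W_def
    proof (rule rat.span_sum)
      fix i assume "i \<in> {..<n}"
      hence "x ^ i \<in> W" unfolding W_def by (intro rat.span_base) auto
      moreover have "- (coeff p i / coeff p n) \<in> \<rat>" using p(1) Ints_Rats by simp
      ultimately show "- (coeff p i / coeff p n) * x ^ i \<in> rat.span ((\<lambda>i. x ^ i) ` {..<n})"
        using Ints_scale unfolding W_def by blast
    qed
    finally show ?thesis .
  qed
  have x_mult: "x * z \<in> W" if "z \<in> W" for z
    using that unfolding W_def
  proof (induction rule: rat.span_induct_alt)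
    case base
    show ?case using rat.span_zero by simp
  next
    case (step c w z)
    then obtain i where i: "i < n" "w = x ^ i" by auto
    have "x * w \<in> W"
    proof (cases "Suc i = n")
      case True
      thus ?thesis using pow_n i by (simp flip: power_Suc)
    next
      case False
      hence "Suc i \<in> {..<n}" using i by simp
      hence "x ^ Suc i \<in> W" unfolding W_def by (intro rat.span_base) blast
      thus ?thesis using i by simp
    qed
    hence "of_rat c * (x * w) + x * z \<in> rat.span ((\<lambda>i. x ^ i) ` {..<n})"
      unfolding W_def using step by (intro rat.span_add rat.span_scale)
    thus ?case by (simp add: algebra_simps)
  qed
  \<comment> \<open>A positive degree puts 1 among the generators of \<open>W\<close>, which starts
    the induction on powers.\<close>
  have "n \<noteq> 0"
    using p unfolding n_def by (metis degree_eq_zeroE poly_pCons poly_0 mult_zero_right add_0_right pCons_0_0)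
  hence "x ^ 0 \<in> W" unfolding W_def by (intro rat.span_base) blast
  hence pow: "x ^ m \<in> W" for m
    by (induction m) (auto intro: x_mult)
  have val: "poly h x \<in> W" if "\<And>i. coeff h i \<in> \<rat>" for h
    unfolding poly_altdef W_def
    by (rule rat.span_sum) (use that pow Ints_scale in \<open>auto simp: W_def\<close>)
  define y where "y = poly g x"
  have coeff_pow: "coeff (g ^ m) i \<in> \<int>" for m i
    by (induction m arbitrary: i) (auto simp: coeff_mult coeff_1 intro!: Ints_sum Ints_mult g)
  have ypow: "y ^ m \<in> W" for m
    using val[of "g ^ m"] coeff_pow Ints_Rats unfolding y_def by (simp add: poly_power)
  show ?thesis
  \<comment> \<open>The dimension count needs \<open>n + 1\<close> distinct vectors. If two powers
    of \<open>y\<close> coincide, the difference of the two monomials already annihilates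
    \<open>y\<close>.\<close>
  proof (cases "inj_on (\<lambda>i. y ^ i) {..n}")
    case False
    then obtain i j where ij: "i \<noteq> j" "y ^ i = y ^ j" by (auto simp: inj_on_def)
    have "algebraic y"
    proof (rule algebraicI)
      show "coeff (monom 1 i - monom 1 j) k \<in> \<int>" for k by simp
      show "monom 1 i - monom 1 j \<noteq> (0 :: complex poly)" using ij(1) by (simp add: monom_eq_iff')
      show "poly (monom 1 i - monom 1 j) y = 0" using ij(2) by (simp add: poly_monom)
    qed
    thus ?thesis by (simp add: y_def)
  next
    case True
    define Y where "Y = (\<lambda>i. y ^ i) ` {..n}"
    have "card Y = Suc n" unfolding Y_def using True by (simp add: card_image)
    moreover have "card ((\<lambda>i. x ^ i) ` {..<n}) \<le> n" using card_image_le[of "{..<n}"] by fastforce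
    moreover have "Y \<subseteq> rat.span ((\<lambda>i. x ^ i) ` {..<n})" using ypow unfolding Y_def W_def by auto
    ultimately have "rat.dependent Y"
      using rat.independent_span_bound[of "(\<lambda>i. x ^ i) ` {..<n}" Y] by fastforce
    then obtain u v where u: "v \<in> Y" "u v \<noteq> (0::rat)" "(\<Sum>v\<in>Y. of_rat (u v) * v) = 0"
      using rat.dependent_finite[of Y] unfolding Y_def by auto
    define h where "h = (\<Sum>i\<le>n. monom (of_rat (u (y ^ i)) :: complex) i)"
    have coeff_h: "coeff h i = (if i \<le> n then of_rat (u (y ^ i)) else 0)" for i
      unfolding h_def by (auto simp: coeff_sum)
    have "algebraic y"
    proof (rule algebraicI')
      show "coeff h i \<in> \<rat>" for i by (simp add: coeff_h)
      obtain i where "i \<le> n" "v = y ^ i" using u(1) unfolding Y_def by auto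
      hence "coeff h i \<noteq> 0" using u(2) by (simp add: coeff_h)
      thus "h \<noteq> 0" by auto
      show "poly h y = 0"
        using u(3) True unfolding Y_def h_def
        by (subst (asm) sum.reindex) (auto simp: poly_sum poly_monom)
    qed
    thus ?thesis by (simp add: y_def)
  qed
qed

lemma countable_algebraic: "countable {x :: complex. algebraic x}"
proof -
  \<comment> \<open>Indexing by coefficient lists makes the index set visibly countable.\<close>
  define roots where "roots cs = {x :: complex. poly (map_poly of_int (Poly cs)) x = 0}" for cs
  have "countable (\<Union>cs\<in>{cs :: int list. Poly cs \<noteq> 0}. roots cs)"
  proof (intro countable_UN)
    fix cs :: "int list" assume "cs \<in> {cs. Poly cs \<noteq> 0}"
    hence "map_poly (of_int :: int \<Rightarrow> complex) (Poly cs) \<noteq> 0"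
      by (subst map_poly_eq_0_iff) auto
    thus "countable (roots cs)" unfolding roots_def by (intro countable_finite poly_roots_finite)
  qed auto
  moreover have "{x. algebraic x} \<subseteq> (\<Union>cs\<in>{cs :: int list. Poly cs \<noteq> 0}. roots cs)"
  proof
    fix x :: complex assume "x \<in> {x. algebraic x}"
    then obtain p where "p \<noteq> 0" "poly (map_poly of_int p) x = 0"
      by (auto elim: algebraicE')
    thus "x \<in> (\<Union>cs\<in>{cs :: int list. Poly cs \<noteq> 0}. roots cs)"
      unfolding roots_def by (intro UN_I[of "coeffs p"]) auto
  qed
  ultimately show ?thesis by (rule countable_subset[rotated])
qed

section \<open>Minimal polynomials and their integer multiples\<close>

lemma rat_poly_common_denominator:
  fixes p :: "rat poly"
  obtains d :: int where "d \<noteq> 0" "\<And>i. of_int d * coeff p i \<in> \<int>"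
proof -
  have "\<exists>d::int. d \<noteq> 0 \<and> (\<forall>i. of_int d * coeff p i \<in> \<int>)"
  proof (induction p)
    case 0
    show ?case by (intro exI[of _ 1]) auto
  next
    case (pCons a p)
    then obtain d :: int where d: "d \<noteq> 0" "\<And>i. of_int d * coeff p i \<in> \<int>" by auto
    obtain r s where a: "a = of_int r / of_int s" "s \<noteq> 0"
      by (metis quotient_of_div quotient_of_denom_pos surj_pair less_irrefl)
    have "of_int (d * s) * coeff (pCons a p) i \<in> \<int>" for i
    proof (cases i)
      case 0
      have "of_int (d * s) * a = of_int (d * r)" using a by simp
      also have "\<dots> \<in> \<int>" by (rule Ints_of_int)
      finally show ?thesis using 0 by simp
    next
      case (Suc j)
      have "of_int (d * s) * coeff p j = of_int s * (of_int d * coeff p j)" by simp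
      also have "\<dots> \<in> \<int>" by (rule Ints_mult[OF Ints_of_int d(2)])
      finally show ?thesis using Suc by simp
    qed
    thus ?case using d(1) a(2) by (intro exI[of _ "d * s"]) auto
  qed
  thus ?thesis using that by blast
qed

text \<open>Take an annihilating polynomial of least degree and make it monic. If it factors, one
  factor has the root and hence, by minimality, the full degree, so the other factor is a
  unit.\<close>

lemma is_min_poly_rat_exists:
  assumes "algebraic \<alpha>"
  obtains p where "is_min_poly_rat p \<alpha>"
proof -
  define R where "R p \<longleftrightarrow> p \<noteq> 0 \<and> poly (map_poly of_rat p) \<alpha> = 0" for p :: "rat poly"
  obtain q where q: "q \<noteq> 0" "poly (map_poly of_int q) \<alpha> = 0"
    using assms by (rule algebraicE')
  have "map_poly (of_rat :: rat \<Rightarrow> complex) (map_poly of_int q) = map_poly of_int q"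
    by (subst map_poly_map_poly) (auto simp: o_def)
  hence "R (map_poly of_int q)" unfolding R_def using q by (auto simp: map_poly_eq_0_iff)
  then obtain p where p: "R p" and min: "\<And>q. R q \<Longrightarrow> degree p \<le> degree q"
    using ex_has_least_nat[of R _ degree] by blast
  define p' where "p' = smult (inverse (lead_coeff p)) p"
  have p0: "p \<noteq> 0" using p by (simp add: R_def)
  have deg: "degree p' = degree p" using p0 by (simp add: p'_def)
  have "R p'" using p unfolding R_def p'_def by (simp add: map_poly_smult of_rat_mult)
  have "degree p' \<noteq> 0"
  proof
    assume "degree p' = 0"
    then obtain c where "p' = [:c:]" by (rule degree_eq_zeroE)
    thus False using \<open>R p'\<close> by (auto simp: R_def map_poly_pCons)
  qed
  have "irreducible p'"
  proof (rule irreducibleI)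
    show "p' \<noteq> 0" using \<open>R p'\<close> by (simp add: R_def)
    show "\<not> p' dvd 1" using \<open>degree p' \<noteq> 0\<close> by (metis is_unit_polyE degree_pCons_0)
    fix a b assume ab: "p' = a * b"
    hence nz: "a \<noteq> 0" "b \<noteq> 0" using \<open>p' \<noteq> 0\<close> by auto
    hence dsum: "degree p' = degree a + degree b" using ab by (simp add: degree_mult_eq)
    have "R a \<or> R b"
      using \<open>R p'\<close> nz unfolding R_def ab by (simp add: poly_map_poly_of_rat_mult)
    hence "degree b = 0 \<or> degree a = 0"
      using min[of a] min[of b] dsum deg by auto
    thus "a dvd 1 \<or> b dvd 1" using nz by (metis is_unit_iff_degree)
  qed
  moreover have "lead_coeff p' = 1" using p0 by (simp add: p'_def)
  ultimately show ?thesis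
    using that[of p'] \<open>R p'\<close> by (simp add: is_min_poly_rat_def R_def)
qed

text \<open>The witness is the minimal polynomial with denominators cleared. That its roots are
  conjugates lets closedness of \<open>S\<close> confine them, within the disc, to \<open>S\<close>.
  The nonzero constant term will make each block begin exactly at its prescribed exponent.\<close>

lemma conjugates_int_poly:
  assumes "algebraic \<alpha>"
  obtains m :: "complex poly" where "\<And>i. coeff m i \<in> \<int>" "m \<noteq> 0" "poly m \<alpha> = 0"
    "\<And>\<beta>. poly m \<beta> = 0 \<Longrightarrow> \<beta> \<in> conjugates \<alpha>" "\<alpha> \<noteq> 0 \<Longrightarrow> poly m 0 \<noteq> 0"
proof -
  obtain p where p: "is_min_poly_rat p \<alpha>" using assms by (rule is_min_poly_rat_exists)
  obtain d :: int where d: "d \<noteq> 0" "\<And>i. of_int d * coeff p i \<in> \<int>"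
    using rat_poly_common_denominator[of p] by blast
  define m where "m = smult (of_int d) (map_poly of_rat p :: complex poly)"
  have m_zero: "poly m \<beta> = 0 \<longleftrightarrow> poly (map_poly of_rat p) \<beta> = 0" for \<beta>
    using d by (simp add: m_def)
  show ?thesis
  proof (rule that[of m])
    fix i
    obtain k where k: "of_int d * coeff p i = of_int k" using d(2) by (auto elim: Ints_cases)
    have "coeff m i = of_rat (of_int d * coeff p i)"
      by (simp add: m_def coeff_map_poly of_rat_mult)
    also have "\<dots> \<in> \<int>" unfolding k by simp
    finally show "coeff m i \<in> \<int>" .
  next
    have "p \<noteq> 0" using p by (auto simp: is_min_poly_rat_def)
    thus "m \<noteq> 0" using d by (simp add: m_def map_poly_eq_0_iff)
  next
    show "poly m \<alpha> = 0" using p by (simp add: m_zero is_min_poly_rat_def)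
  next
    show "\<beta> \<in> conjugates \<alpha>" if "poly m \<beta> = 0" for \<beta>
      using that p by (auto simp: m_zero conjugates_def)
  next
    assume "\<alpha> \<noteq> 0"
    show "poly m 0 \<noteq> 0"
    proof
      assume "poly m 0 = 0"
      hence "coeff p 0 = 0" by (simp only: m_zero) (simp add: poly_0_coeff_0 coeff_map_poly)
      \<comment> \<open>The variable divides the irreducible \<open>p\<close>, so \<open>p\<close>
        is a constant multiple of it and 0 is its only root.\<close>
      then obtain r where r: "p = [:0, 1:] * r"
        by (metis poly_0_coeff_0 poly_eq_0_iff_dvd minus_zero dvdE)
      moreover have "\<not> [:0, 1 :: rat:] dvd 1" by (simp add: is_unit_iff_degree)
      ultimately have "r dvd 1" using p unfolding is_min_poly_rat_def
        by (blast dest: irreducibleD)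
      then obtain c where c: "r = [:c:]" "c \<noteq> 0" 
        by (metis is_unit_polyE is_unit_iff_degree degree_eq_zeroE pCons_0_0 not_is_unit_0)
      have "poly (map_poly of_rat p) \<alpha> = of_rat c * \<alpha>"
        unfolding r c by (simp add: map_poly_pCons)
      thus False using p \<open>\<alpha> \<noteq> 0\<close> c by (simp add: is_min_poly_rat_def)
    qed
  qed
qed

section \<open>Power series with gaps\<close>

text \<open>Multiplying by a common denominator \<open>q\<close> of the coefficients turns rational
  functions into polynomials, so the relation descends from Laurent series to power series.\<close>

lemma algebraic_fps_poly_relation:
  assumes "algebraic_fps f"
  obtains R :: "complex poly poly" where "R \<noteq> 0"
    "(\<Sum>i\<le>degree R. fps_of_poly (coeff R i) * f ^ i) = 0"
proof -
  define emb where "emb p = fps_to_fls (fps_of_poly p)" for p :: "complex poly"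
  have emb_mult: "emb (p * q) = emb p * emb q" for p q
    by (simp add: emb_def fps_of_poly_mult fls_times_fps_to_fls)
  have emb_eq_0: "emb p = 0 \<longleftrightarrow> p = 0" for p
    using fps_of_poly_eq_iff[of p 0] by (simp add: emb_def)
  obtain P where P: "P \<noteq> 0" "\<And>i. coeff P i \<in> rational_functions" "poly P (fps_to_fls f) = 0"
    using assms by (auto simp: algebraic_fps_def)
  have "\<exists>q. q \<noteq> 0 \<and> (\<forall>i\<le>n. \<exists>r. emb q * coeff P i = emb r)" for n
  proof (induction n)
    case 0
    obtain p q where "coeff P 0 = emb p / emb q" "q \<noteq> 0"
      using P(2)[of 0] by (auto simp: rational_functions_def emb_def)
    thus ?case by (intro exI[of _ q]) (auto simp: emb_eq_0)
  next
    case (Suc n)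
    then obtain q where q: "q \<noteq> 0" "\<And>i. i \<le> n \<Longrightarrow> \<exists>r. emb q * coeff P i = emb r" by auto
    obtain p' q' where pq: "coeff P (Suc n) = emb p' / emb q'" "q' \<noteq> 0"
      using P(2)[of "Suc n"] by (auto simp: rational_functions_def emb_def)
    have "\<exists>r. emb (q * q') * coeff P i = emb r" if i: "i \<le> Suc n" for i
    proof (cases "i = Suc n")
      case True
      thus ?thesis using pq by (intro exI[of _ "q * p'"]) (simp add: emb_mult emb_eq_0)
    next
      case False
      then obtain r where "emb q * coeff P i = emb r" using q(2) i by (metis le_Suc_eq)
      hence "emb (q * q') * coeff P i = emb (q' * r)" by (simp add: emb_mult mult_ac)
      thus ?thesis by blast
    qed
    thus ?case using q(1) pq(2) by (intro exI[of _ "q * q'"]) auto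
  qed
  then obtain q where q: "q \<noteq> 0" "\<forall>i\<le>degree P. \<exists>r. emb q * coeff P i = emb r" by blast
  then obtain r where r: "\<And>i. i \<le> degree P \<Longrightarrow> emb q * coeff P i = emb (r i)" by metis
  define R where "R = (\<Sum>i\<le>degree P. monom (r i) i)"
  have coeff_R: "coeff R i = (if i \<le> degree P then r i else 0)" for i
    by (auto simp: R_def coeff_sum)
  \<comment> \<open>Clearing denominators preserves the leading term, so the new relation is
    nontrivial and has the same degree.\<close>
  have "emb q * lead_coeff P \<noteq> 0" using P(1) q(1) by (simp add: emb_eq_0)
  hence "emb (r (degree P)) \<noteq> 0" using r[of "degree P"] by simp
  hence lead: "coeff R (degree P) \<noteq> 0" by (simp add: coeff_R emb_eq_0)
  have degR: "degree R = degree P"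
    by (rule antisym[OF degree_le le_degree[OF lead]]) (simp add: coeff_R)
  have "fps_to_fls (\<Sum>i\<le>degree R. fps_of_poly (coeff R i) * f ^ i)
      = (\<Sum>i\<le>degree P. emb (r i) * fps_to_fls f ^ i)"
  proof -
    have "fps_to_fls (\<Sum>i\<in>A. g i) = (\<Sum>i\<in>A. fps_to_fls (g i))" for A and g :: "nat \<Rightarrow> complex fps"
      by (induction A rule: infinite_finite_induct) auto
    thus ?thesis
      by (simp add: degR coeff_R emb_def fls_times_fps_to_fls fps_to_fls_power)
  qed
  also have "\<dots> = emb q * poly P (fps_to_fls f)"
    by (simp add: poly_altdef sum_distrib_left r[symmetric] mult_ac)
  also have "\<dots> = 0" using P(3) by simp
  finally have "(\<Sum>i\<le>degree R. fps_of_poly (coeff R i) * f ^ i) = 0" by simp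
  moreover have "R \<noteq> 0" using lead by auto
  ultimately show ?thesis using that by blast
qed

text \<open>\<open>R\<close> is read as a polynomial in two variables: its coefficients are
  polynomials in z, and \<open>s\<close> replaces the outer variable.\<close>

lemma degree_poly_poly_le:
  fixes R :: "'a::comm_ring_1 poly poly"
  assumes "\<And>i. degree (coeff R i) \<le> D"
  shows "degree (poly R s) \<le> D + degree R * degree s"
  unfolding poly_altdef
proof (rule degree_sum_le)
  fix i assume i: "i \<in> {..degree R}"
  have "degree (coeff R i * s ^ i) \<le> degree (coeff R i) + degree (s ^ i)" by (rule degree_mult_le)
  also have "\<dots> \<le> D + degree s * i" by (intro add_mono assms degree_power_le)
  also have "\<dots> \<le> D + degree R * degree s" using i by (simp add: mult.commute)
  finally show "degree (coeff R i * s ^ i) \<le> D + degree R * degree s" .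
qed auto

text \<open>
  If \<open>R(z, f) = 0\<close> then \<open>R(z, s)\<close> vanishes at \<open>0\<close> to high order for every truncation \<open>s\<close> of \<open>f\<close> in
  front of a gap. A gap that is long relative to the degree of \<open>s\<close> forces \<open>R(z, s) = 0\<close>, but \<open>R\<close> has
  only finitely many roots.
\<close>

lemma transcendental_fps_gaps:
  fixes f :: "complex fps" and t T :: "nat \<Rightarrow> nat"
  assumes t: "strict_mono t" and nz: "\<And>k. fps_nth f (t k) \<noteq> 0"
    and gap: "\<And>k n. T k < n \<Longrightarrow> n < t (Suc k) \<Longrightarrow> fps_nth f n = 0"
    and large: "\<And>k. k * T k + k < t (Suc k)"
  shows "transcendental_fps f"
  unfolding transcendental_fps_def
proof
  assume "algebraic_fps f"
  then obtain R where R: "R \<noteq> 0" "(\<Sum>i\<le>degree R. fps_of_poly (coeff R i) * f ^ i) = 0"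
    by (rule algebraic_fps_poly_relation)
  define D where "D = (\<Sum>i\<le>degree R. degree (coeff R i))"
  have D: "degree (coeff R i) \<le> D" for i
  proof (cases "i \<le> degree R")
    case True
    thus ?thesis unfolding D_def by (intro member_le_sum) auto
  qed (simp add: coeff_eq_0)
  define s where "s k = truncate_fps (t (Suc k)) f" for k
  have coeff_s: "coeff (s k) n = (if n < t (Suc k) then fps_nth f n else 0)" for k n
    by (simp add: s_def coeff_truncate_fps)
  have deg_s: "degree (s k) \<le> T k" for k
    by (rule degree_le) (auto simp: coeff_s gap)
  \<comment> \<open>The nonzero coefficient at \<open>t l\<close> is cut off in \<open>s k\<close>
    but retained in \<open>s l\<close>.\<close>
  have s_neq: "s k \<noteq> s l" if "k < l" for k l
  proof
    assume "s k = s l"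
    hence "coeff (s k) (t l) = coeff (s l) (t l)" by simp
    moreover have "t (Suc k) \<le> t l" using that t by (simp add: strict_mono_less_eq)
    moreover have "t l < t (Suc l)" using t by (simp add: strict_mono_less)
    ultimately show False using nz[of l] by (simp add: coeff_s)
  qed
  have "inj s" by (rule injI) (metis s_neq linorder_neqE_nat)
  have root: "poly R (s k) = 0" if k: "k \<ge> D + degree R" for k
  proof (rule ccontr)
    define g where "g = poly R (s k)"
    assume "poly R (s k) \<noteq> 0"
    have "degree g \<le> D + degree R * degree (s k)" unfolding g_def by (rule degree_poly_poly_le[OF D])
    also have "\<dots> \<le> k + k * T k" using k by (intro add_mono mult_mono deg_s) auto
    finally have deg: "degree g < t (Suc k)" using large[of k] by simp
    define h where "h = fps_of_poly (s k)"
    have dvd1: "fps_X ^ t (Suc k) dvd h - f"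
    proof -
      have "h - f = fps_X ^ t (Suc k) * (- fps_shift (t (Suc k)) f)"
        by (rule fps_ext) (auto simp: h_def coeff_s fps_X_power_mult_nth)
      thus ?thesis by simp
    qed
    have "fps_of_poly g = (\<Sum>i\<le>degree R. fps_of_poly (coeff R i) * h ^ i)"
      by (simp add: g_def h_def poly_altdef fps_of_poly_sum fps_of_poly_mult fps_of_poly_power)
    also have "\<dots> = (\<Sum>i\<le>degree R. fps_of_poly (coeff R i) * (h ^ i - f ^ i))"
      using R(2) by (simp add: right_diff_distrib sum_subtractf)
    finally have eq: "fps_of_poly g = (\<Sum>i\<le>degree R. fps_of_poly (coeff R i) * (h ^ i - f ^ i))" .
    \<comment> \<open>Each \<open>h ^ i - f ^ i\<close> is a multiple of \<open>h - f\<close>, which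
      vanishes to order \<open>t (Suc k)\<close>.\<close>
    have "fps_X ^ t (Suc k) dvd fps_of_poly g"
      unfolding eq by (intro dvd_sum dvd_mult dvd_trans[OF dvd1]) (simp add: power_diff_sumr2)
    then obtain u where "fps_of_poly g = fps_X ^ t (Suc k) * u" by (rule dvdE)
    \<comment> \<open>The order of vanishing exceeds the degree of \<open>g\<close>, so even the
      leading coefficient of \<open>g\<close> is zero.\<close>
    hence "fps_nth (fps_of_poly g) (degree g) = 0" using deg by (simp add: fps_X_power_mult_nth)
    thus False using \<open>poly R (s k) \<noteq> 0\<close> by (simp add: g_def)
  qed
  have "s ` {D + degree R..} \<subseteq> {x. poly R x = 0}" using root by auto
  moreover have "finite {x. poly R x = 0}" using R(1) by (rule poly_roots_finite)
  ultimately have "finite (s ` {D + degree R..})" by (rule finite_subset)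
  hence "finite {D + degree R..}" using \<open>inj s\<close> by (metis finite_imageD inj_on_subset subset_UNIV)
  thus False using infinite_Ici by blast
qed

section \<open>Density of the zero coefficients, and rapidly growing exponents\<close>

text \<open>Let \<open>K\<close> be the last block starting at or before \<open>x\<close>. The
  exceptions up to \<open>x\<close> number at most the total length of blocks 0 to \<open>K\<close>,
  and \<open>K\<close> times this length is at most \<open>t K \<le> x\<close>. Since
  \<open>K\<close> tends to infinity with \<open>x\<close>, the exceptions have density 0.\<close>

lemma has_natural_density_1_blocks:
  fixes A :: "nat set" and t b :: "nat \<Rightarrow> nat"
  assumes t: "strict_mono t" and sub: "- A \<subseteq> (\<Union>k. {t k..<t k + b k})"
    and b: "\<And>k. k * (\<Sum>j\<le>k. b j) \<le> t k"
  shows "has_natural_density A 1"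
proof -
  have fin: "finite {n. real n \<le> x}" for x :: real
    by (rule finite_subset[of _ "{..nat \<lfloor>x\<rfloor>}"]) (use le_nat_floor in blast, simp)
  define N where "N x = card {n \<in> - A. real n \<le> x}" for x :: real
  have N_le: "real m * real (N x) \<le> x" if "real (t m) \<le> x" for m x
  proof -
    define K where "K = Max {k. real (t k) \<le> x}"
    have "{k. real (t k) \<le> x} \<subseteq> {n. real n \<le> x}"
    proof safe
      fix k assume "real (t k) \<le> x"
      moreover have "real k \<le> real (t k)" using strict_mono_imp_increasing[OF t, of k] by simp
      ultimately show "real k \<le> x" by linarith
    qed
    hence finK: "finite {k. real (t k) \<le> x}" using fin finite_subset by blast
    have K: "real (t K) \<le> x" "m \<le> K" "\<And>k. real (t k) \<le> x \<Longrightarrow> k \<le> K"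
      unfolding K_def using Max_in[OF finK] Max_ge[OF finK] that by auto
    have "{n \<in> - A. real n \<le> x} \<subseteq> (\<Union>k\<le>K. {t k..<t k + b k})"
    proof
      fix n assume "n \<in> {n \<in> - A. real n \<le> x}"
      moreover from this obtain k where "n \<in> {t k..<t k + b k}" using sub by auto
      ultimately show "n \<in> (\<Union>k\<le>K. {t k..<t k + b k})" using K(3)[of k] by auto
    qed
    hence "N x \<le> card (\<Union>k\<le>K. {t k..<t k + b k})" unfolding N_def by (intro card_mono) auto
    also have "\<dots> \<le> (\<Sum>k\<le>K. card {t k..<t k + b k})" by (rule card_UN_le) simp
    finally have "N x \<le> (\<Sum>k\<le>K. b k)" by simp
    hence "m * N x \<le> K * (\<Sum>k\<le>K. b k)" using K(2) by (intro mult_mono) auto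
    also have "\<dots> \<le> t K" by (rule b)
    finally have "real (m * N x) \<le> real (t K)" by (simp only: of_nat_le_iff)
    thus ?thesis using K(1) by simp
  qed
  have N_lim: "((\<lambda>x. real (N x) / x) \<longlongrightarrow> 0) at_top"
  proof (rule tendstoI)
    fix e :: real assume "e > 0"
    then obtain m where m: "inverse (real (Suc m)) < e" using reals_Archimedean by blast
    have "eventually (\<lambda>x. x \<ge> max 1 (real (t (Suc m)))) at_top" by (rule eventually_ge_at_top)
    thus "eventually (\<lambda>x. dist (real (N x) / x) 0 < e) at_top"
    proof eventually_elim
      case (elim x)
      have "real (Suc m) * real (N x) \<le> x" using elim by (intro N_le) simp
      hence "real (N x) / x \<le> inverse (real (Suc m))" using elim by (simp add: field_simps)
      thus ?case using m elim by simp
    qed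
  qed
  \<comment> \<open>The extra 1 in the numerator counts the index 0.\<close>
  have card_eq: "real (card {n \<in> A. real n \<le> x}) / x = (real_of_int \<lfloor>x\<rfloor> + 1) / x - real (N x) / x"
    if "x \<ge> 1" for x
  proof -
    have "real n \<le> x \<longleftrightarrow> n \<le> nat \<lfloor>x\<rfloor>" for n using that by linarith
    hence "{n. real n \<le> x} = {..nat \<lfloor>x\<rfloor>}" by blast
    hence "card {n. real n \<le> x} = nat \<lfloor>x\<rfloor> + 1" by simp
    moreover have "card {n. real n \<le> x} = card ({n \<in> A. real n \<le> x} \<union> {n \<in> - A. real n \<le> x})"
      by (rule arg_cong[of _ _ card]) auto
    moreover have "\<dots> = card {n \<in> A. real n \<le> x} + N x"
      unfolding N_def by (rule card_Un_disjoint) (auto intro: finite_subset[OF _ fin[of x]])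
    ultimately have "real (card {n \<in> A. real n \<le> x}) = real (nat \<lfloor>x\<rfloor>) + 1 - real (N x)" by linarith
    thus ?thesis using that by (simp add: diff_divide_distrib)
  qed
  have "((\<lambda>x. (real_of_int \<lfloor>x\<rfloor> + 1) / x) \<longlongrightarrow> 1) at_top"
  proof (rule tendsto_sandwich)
    show "eventually (\<lambda>x::real. 1 \<le> (real_of_int \<lfloor>x\<rfloor> + 1) / x) at_top"
      using eventually_gt_at_top[of 0] by eventually_elim (simp add: field_simps, linarith)
    show "eventually (\<lambda>x::real. (real_of_int \<lfloor>x\<rfloor> + 1) / x \<le> 1 + 1 / x) at_top"
      using eventually_gt_at_top[of 0] by eventually_elim (simp add: field_simps)
    show "((\<lambda>x::real. 1 + 1 / x) \<longlongrightarrow> 1) at_top"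
      using tendsto_add[OF tendsto_const tendsto_inverse_0_at_top[OF filterlim_ident], of 1]
      by (simp add: field_simps)
  qed simp
  from tendsto_diff[OF this N_lim]
  have "((\<lambda>x. (real_of_int \<lfloor>x\<rfloor> + 1) / x - real (N x) / x) \<longlongrightarrow> 1) at_top" by simp
  thus ?thesis
    unfolding has_natural_density_def
    by (rule Lim_transform_eventually)
       (use eventually_ge_at_top[of 1] in eventually_elim, simp add: card_eq)
qed

text \<open>Every requirement on the exponents holds for all large values, given only the preceding
  exponent, so they can be chosen one after another.\<close>

lemma exists_fast_growing_sequence:
  fixes P :: "nat \<Rightarrow> nat \<Rightarrow> nat \<Rightarrow> bool"
  assumes "\<And>k. eventually (Q k) sequentially" and "\<And>k m. eventually (P k m) sequentially"
  obtains t :: "nat \<Rightarrow> nat" where "strict_mono t" "\<And>k. Q k (t k)" "\<And>k. P k (t k) (t (Suc k))"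
proof -
  have "\<exists>t. \<forall>k. Q k (t k) \<and> (t k < t (Suc k) \<and> P k (t k) (t (Suc k)))"
  proof (rule dependent_nat_choice)
    show "\<exists>n. Q 0 n" using assms(1)[of 0] by (auto simp: eventually_sequentially)
    fix m k
    have "eventually (\<lambda>n. Q (Suc k) n \<and> m < n \<and> P k m n) sequentially"
      by (intro eventually_conj assms eventually_gt_at_top)
    thus "\<exists>n. Q (Suc k) n \<and> (m < n \<and> P k m n)" by (auto simp: eventually_sequentially)
  qed
  thus ?thesis using that by (auto simp: strict_mono_Suc_iff)
qed

section \<open>The block series\<close>

text \<open>\<open>gap\<close> separates the blocks by zeros long enough for transcendence; its
  factor \<open>Suc k\<close> instead of \<open>k\<close> keeps blocks 0 and 1 disjoint too.
  \<open>small\<close> bounds the radius of convergence from below: its base tends to 1 and so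
  eventually exceeds \<open>r / \<rho>\<close> for any \<open>r < \<rho>\<close>.
  \<open>sparse\<close> gives the density.\<close>

locale block_series =
  fixes \<rho> :: real and Q :: "nat \<Rightarrow> complex poly" and t :: "nat \<Rightarrow> nat"
  assumes rho_pos: "0 < \<rho>" and rho_le_1: "\<rho> \<le> 1"
    and Q_int: "\<And>k i. coeff (Q k) i \<in> \<int>"
    and Q_0: "\<And>k. coeff (Q k) 0 \<noteq> 0"
    and t_mono: "strict_mono t"
    and gap: "\<And>k. Suc k * (t k + degree (Q k)) + k < t (Suc k)"
    and small: "\<And>k. (real (k + 1) / real (k + 2)) ^ t k * (\<Sum>i\<le>degree (Q k). norm (coeff (Q k) i)) \<le> 1"
    and sparse: "\<And>k. k * (\<Sum>j\<le>k. degree (Q j) + 1) \<le> t k"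
begin

text \<open>Rounding keeps the coefficients integral and costs at most a factor 2, which does not
  affect the radius.\<close>

definition scale :: "nat \<Rightarrow> int" where "scale k = \<lfloor>(1 / \<rho>) ^ t k\<rfloor>"

definition block :: "nat \<Rightarrow> complex poly" where "block k = monom (of_int (scale k)) (t k) * Q k"

text \<open>Digits 1 and 2 are nonzero, so no choice removes a block, and two different digits
  differ by exactly 1 in norm.\<close>

definition digit :: "(nat \<Rightarrow> bool) \<Rightarrow> nat \<Rightarrow> complex" where "digit \<epsilon> k = (if \<epsilon> k then 2 else 1)"

text \<open>The sum stops at \<open>n\<close> because the \<open>k\<close>-th block starts at \<open>t k \<ge> k\<close>.\<close>

definition series :: "(nat \<Rightarrow> bool) \<Rightarrow> complex fps" where
  "series \<epsilon> = Abs_fps (\<lambda>n. \<Sum>k\<le>n. digit \<epsilon> k * coeff (block k) n)"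

section \<open>Coefficients of the block series\<close>

lemma t_ge: "k \<le> t k"
  using t_mono by (rule strict_mono_imp_increasing)

lemma scale_bounds: "1 \<le> scale k" "real_of_int (scale k) \<le> (1 / \<rho>) ^ t k" "(1 / \<rho>) ^ t k \<le> 2 * real_of_int (scale k)"
proof -
  have "1 \<le> (1 / \<rho>) ^ t k" using rho_pos rho_le_1 by (intro one_le_power) simp
  thus M1: "1 \<le> scale k" unfolding scale_def by simp
  show "real_of_int (scale k) \<le> (1 / \<rho>) ^ t k" unfolding scale_def by simp
  have "(1 / \<rho>) ^ t k < real_of_int (scale k) + 1" unfolding scale_def by linarith
  also have "\<dots> \<le> 2 * real_of_int (scale k)" using M1 by linarith
  finally show "(1 / \<rho>) ^ t k \<le> 2 * real_of_int (scale k)" by simp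
qed

lemma digit_simps [simp]: "digit \<epsilon> k \<in> \<int>" "digit \<epsilon> k \<noteq> 0" "norm (digit \<epsilon> k) \<le> 2"
  by (auto simp: digit_def)

lemma coeff_block: "coeff (block k) n = (if n < t k then 0 else of_int (scale k) * coeff (Q k) (n - t k))"
  by (simp add: block_def coeff_monom_mult)

lemma coeff_block_int: "coeff (block k) n \<in> \<int>"
  by (auto simp: coeff_block intro!: Ints_mult Q_int)

lemma coeff_block_eq_0: "n \<notin> {t k..t k + degree (Q k)} \<Longrightarrow> coeff (block k) n = 0"
  by (auto simp: coeff_block intro!: coeff_eq_0)

lemma poly_block: "poly (block k) z = of_int (scale k) * z ^ t k * poly (Q k) z"
  by (simp add: block_def poly_monom)

lemma block_less:
  assumes "j < k"
  shows "t j + degree (Q j) < t k"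
proof -
  have "t j + degree (Q j) < t (Suc j)" using gap[of j] by simp
  also have "\<dots> \<le> t k" using assms t_mono by (simp add: strict_mono_less_eq)
  finally show ?thesis .
qed

lemma degree_block_less:
  assumes "j < k"
  shows "degree (block j) < t k"
proof -
  have "degree (block j) \<le> t j + degree (Q j)"
    by (rule degree_le) (auto intro: coeff_block_eq_0)
  thus ?thesis using block_less[OF assms] by simp
qed

lemma series_nth:
  assumes "n < t K"
  shows "fps_nth (series \<epsilon>) n = (\<Sum>k<K. digit \<epsilon> k * coeff (block k) n)"
proof -
  have zero: "coeff (block k) n = 0" if "k > n \<or> k \<ge> K" for k
  proof -
    have "n < t k" using that t_ge[of k] assms t_mono
      by (auto dest: strict_mono_less_eq[of t K k])
    thus ?thesis by (simp add: coeff_block)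
  qed
  have "fps_nth (series \<epsilon>) n = (\<Sum>k\<le>n. digit \<epsilon> k * coeff (block k) n)" by (simp add: series_def)
  also have "\<dots> = (\<Sum>k\<in>{..n} \<union> {..<K}. digit \<epsilon> k * coeff (block k) n)"
    by (rule sum.mono_neutral_left) (auto simp: zero)
  also have "\<dots> = (\<Sum>k<K. digit \<epsilon> k * coeff (block k) n)"
    by (rule sum.mono_neutral_right) (auto simp: zero)
  finally show ?thesis .
qed

lemma series_int: "fps_nth (series \<epsilon>) n \<in> \<int>"
  by (auto simp: series_def intro!: Ints_sum Ints_mult coeff_block_int)

lemma series_nth_eq_0:
  assumes "\<And>k. n \<notin> {t k..t k + degree (Q k)}"
  shows "fps_nth (series \<epsilon>) n = 0"
  unfolding series_def using coeff_block_eq_0[OF assms] by simp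

lemma series_nth_block:
  assumes "n \<in> {t k..t k + degree (Q k)}"
  shows "fps_nth (series \<epsilon>) n = digit \<epsilon> k * coeff (block k) n"
proof -
  have "n < t (Suc k)" using assms block_less[of k "Suc k"] by simp
  hence "fps_nth (series \<epsilon>) n = (\<Sum>j<Suc k. digit \<epsilon> j * coeff (block j) n)" by (rule series_nth)
  also have "\<dots> = (\<Sum>j\<in>{k}. digit \<epsilon> j * coeff (block j) n)"
  proof (rule sum.mono_neutral_right)
    show "\<forall>j\<in>{..<Suc k} - {k}. digit \<epsilon> j * coeff (block j) n = 0"
    proof
      fix j assume "j \<in> {..<Suc k} - {k}"
      hence "t j + degree (Q j) < n" using block_less[of j k] assms by auto
      thus "digit \<epsilon> j * coeff (block j) n = 0" by (simp add: coeff_block_eq_0)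
    qed
  qed auto
  finally show ?thesis by simp
qed

lemma series_nth_t: "fps_nth (series \<epsilon>) (t k) = digit \<epsilon> k * (of_int (scale k) * coeff (Q k) 0)"
  using series_nth_block[of "t k" k \<epsilon>] by (simp add: coeff_block)

lemma series_nth_t_neq_0: "fps_nth (series \<epsilon>) (t k) \<noteq> 0"
  using scale_bounds(1)[of k] Q_0[of k] by (simp add: series_nth_t)

lemma series_gap:
  assumes "t k + degree (Q k) < n" "n < t (Suc k)"
  shows "fps_nth (series \<epsilon>) n = 0"
proof (rule series_nth_eq_0)
  fix j
  show "n \<notin> {t j..t j + degree (Q j)}"
  proof (cases "j \<le> k")
    case True
    hence "t j + degree (Q j) \<le> t k + degree (Q k)"
      using block_less[of j k] by (cases "j = k") auto
    thus ?thesis using assms(1) by auto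
  next
    case False
    hence "t (Suc k) \<le> t j" using t_mono by (simp add: strict_mono_less_eq)
    thus ?thesis using assms(2) by auto
  qed
qed

text \<open>The coefficient at \<open>t k\<close> reveals the digit; this carries uncountability
  from digit sequences to power series.\<close>

lemma inj_series: "inj series"
proof (rule injI, rule ext)
  fix \<epsilon> \<epsilon>' k assume "series \<epsilon> = series \<epsilon>'"
  hence "fps_nth (series \<epsilon>) (t k) = fps_nth (series \<epsilon>') (t k)" by simp
  hence "digit \<epsilon> k = digit \<epsilon>' k" using scale_bounds(1)[of k] Q_0[of k] by (simp add: series_nth_t)
  thus "\<epsilon> k = \<epsilon>' k" by (auto simp: digit_def split: if_splits)
qed

lemma transcendental_series: "transcendental_fps (series \<epsilon>)"
proof (rule transcendental_fps_gaps[OF t_mono series_nth_t_neq_0])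
  show "k * (t k + degree (Q k)) + k < t (Suc k)" for k using gap[of k] by simp
qed (rule series_gap)

lemma density_series: "has_natural_density (zero_coeffs (series \<epsilon>)) 1"
proof (rule has_natural_density_1_blocks[OF t_mono])
  show "- zero_coeffs (series \<epsilon>) \<subseteq> (\<Union>k. {t k..<t k + (degree (Q k) + 1)})"
    using series_nth_eq_0[of _ \<epsilon>] by (fastforce simp: zero_coeffs_def)
qed (rule sparse)

section \<open>Radius of convergence\<close>

text \<open>In block \<open>k\<close> the quantity is at most
  \<open>2 * ((r / \<rho>) ^ t k * H k)\<close>, because \<open>r < 1\<close> allows replacing
  \<open>r ^ n\<close> by \<open>r ^ t k\<close>. For large \<open>k\<close> the assumption
  \<open>small\<close> bounds this by 2; the finitely many other blocks are absorbed into
  \<open>C\<close>.\<close>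

lemma norm_series_bounded:
  assumes r: "0 < r" "r < \<rho>"
  obtains C where "\<And>n. norm (fps_nth (series \<epsilon>) n) * r ^ n \<le> C"
proof -
  define H where "H k = (\<Sum>i\<le>degree (Q k). norm (coeff (Q k) i))" for k
  have H_nonneg: "0 \<le> H k" for k unfolding H_def by (intro sum_nonneg) simp
  have H_ge: "norm (coeff (Q k) i) \<le> H k" for k i
  proof (cases "i \<le> degree (Q k)")
    case True
    thus ?thesis unfolding H_def by (intro member_le_sum) auto
  qed (simp add: coeff_eq_0 H_nonneg)
  \<comment> \<open>For \<open>k \<ge> k0\<close> this choice ensures
    \<open>r / \<rho> \<le> 1 - 1 / (k + 2)\<close>, the base occurring in
    \<open>small\<close>.\<close>
  obtain k0 where k0: "1 / (1 - r / \<rho>) \<le> real k0" using real_arch_simple by blast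
  have q: "0 < r / \<rho>" "r / \<rho> < 1" using r by auto
  define C where "C = 2 + 2 * (\<Sum>k<k0. H k)"
  have sum_nonneg: "0 \<le> (\<Sum>k<k0. H k)" by (intro sum_nonneg H_nonneg)
  have block_bound: "(r / \<rho>) ^ t k * H k \<le> 1 + (\<Sum>k<k0. H k)" for k
  proof (cases "k < k0")
    case True
    have "(r / \<rho>) ^ t k * H k \<le> 1 * H k"
      using q by (intro mult_right_mono power_le_one H_nonneg) auto
    also have "\<dots> \<le> (\<Sum>k<k0. H k)" using True H_nonneg by (simp, intro member_le_sum) auto
    finally show ?thesis by simp
  next
    case False
    hence "1 / (1 - r / \<rho>) \<le> real (k + 2)" using k0 by simp
    hence "1 \<le> real (k + 2) * (1 - r / \<rho>)" using q by (simp add: pos_divide_le_eq)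
    hence "r / \<rho> * real (k + 2) \<le> real (k + 1)" by (simp add: algebra_simps)
    hence "r / \<rho> \<le> real (k + 1) / real (k + 2)" by (subst pos_le_divide_eq) auto
    hence "(r / \<rho>) ^ t k * H k \<le> (real (k + 1) / real (k + 2)) ^ t k * H k"
      using q by (intro mult_right_mono power_mono H_nonneg) auto
    also have "\<dots> \<le> 1" using small[of k] by (simp add: H_def)
    finally show ?thesis using sum_nonneg by simp
  qed
  have "norm (fps_nth (series \<epsilon>) n) * r ^ n \<le> C" for n
  proof (cases "\<exists>k. n \<in> {t k..t k + degree (Q k)}")
    case False
    thus ?thesis using series_nth_eq_0[of n \<epsilon>] sum_nonneg by (simp add: C_def)
  next
    case True
    then obtain k where k: "n \<in> {t k..t k + degree (Q k)}" by blast
    have "norm (fps_nth (series \<epsilon>) n) = norm (digit \<epsilon> k) * (real_of_int (scale k) * norm (coeff (Q k) (n - t k)))"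
      using k scale_bounds(1)[of k] by (simp add: series_nth_block[OF k] coeff_block norm_mult)
    also have "\<dots> \<le> 2 * ((1 / \<rho>) ^ t k * H k)"
      using scale_bounds[of k] rho_pos by (intro mult_mono H_ge) auto
    finally have 1: "norm (fps_nth (series \<epsilon>) n) \<le> 2 * ((1 / \<rho>) ^ t k * H k)" .
    have "r ^ n \<le> r ^ t k" using r rho_le_1 k by (intro power_decreasing) auto
    hence "norm (fps_nth (series \<epsilon>) n) * r ^ n \<le> 2 * ((1 / \<rho>) ^ t k * H k) * r ^ t k"
      using 1 r rho_pos by (intro mult_mono mult_nonneg_nonneg H_nonneg) auto
    also have "\<dots> = 2 * ((r / \<rho>) ^ t k * H k)" by (simp add: power_divide)
    also have "\<dots> \<le> C" using block_bound[of k] by (simp add: C_def)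
    finally show ?thesis .
  qed
  thus ?thesis using that by blast
qed

text \<open>At the point \<open>\<rho>\<close> the terms with index \<open>t k\<close> have norm at
  least 1/2, so the series diverges there. Below \<open>\<rho>\<close> the bounded coefficients give
  convergence by Abel's lemma.\<close>

lemma conv_radius_series: "fps_conv_radius (series \<epsilon>) = ereal \<rho>"
proof (rule antisym)
  have "\<not> summable (\<lambda>n. fps_nth (series \<epsilon>) n * complex_of_real \<rho> ^ n)"
  proof
    assume "summable (\<lambda>n. fps_nth (series \<epsilon>) n * complex_of_real \<rho> ^ n)"
    hence "(\<lambda>n. fps_nth (series \<epsilon>) n * complex_of_real \<rho> ^ n) \<longlonglongrightarrow> 0" by (rule summable_LIMSEQ_zero)
    hence "(\<lambda>k. fps_nth (series \<epsilon>) (t k) * complex_of_real \<rho> ^ t k) \<longlonglongrightarrow> 0"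
      using LIMSEQ_subseq_LIMSEQ[OF _ t_mono] by (force simp: o_def)
    then obtain k where k: "norm (fps_nth (series \<epsilon>) (t k) * complex_of_real \<rho> ^ t k) < 1 / 2"
      using LIMSEQ_D[of _ 0 "1 / 2"] by fastforce
    have "1 \<le> norm (coeff (Q k) 0)"
      using Q_int[of k 0] Q_0[of k] by (auto elim!: Ints_cases)
    moreover have "1 \<le> norm (digit \<epsilon> k)" by (simp add: digit_def)
    ultimately have "1 * (real_of_int (scale k) * 1) \<le> norm (digit \<epsilon> k) * (real_of_int (scale k) * norm (coeff (Q k) 0))"
      using scale_bounds(1)[of k] by (intro mult_mono) auto
    hence "real_of_int (scale k) \<le> norm (fps_nth (series \<epsilon>) (t k))"
      using scale_bounds(1)[of k] by (simp add: series_nth_t norm_mult)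
    hence "1 / 2 * (1 / \<rho>) ^ t k * \<rho> ^ t k \<le> norm (fps_nth (series \<epsilon>) (t k)) * \<rho> ^ t k"
      using scale_bounds(3)[of k] rho_pos by (intro mult_right_mono) auto
    moreover have "1 / 2 * (1 / \<rho>) ^ t k * \<rho> ^ t k = 1 / 2"
      using rho_pos by (simp add: power_divide)
    ultimately have "1 / 2 \<le> norm (fps_nth (series \<epsilon>) (t k)) * \<rho> ^ t k" by linarith
    thus False using k rho_pos by (simp add: norm_mult norm_power)
  qed
  hence "conv_radius (fps_nth (series \<epsilon>)) \<le> norm (complex_of_real \<rho>)" by (rule conv_radius_leI')
  thus "fps_conv_radius (series \<epsilon>) \<le> ereal \<rho>" using rho_pos by (simp add: fps_conv_radius_def)
  show "ereal \<rho> \<le> fps_conv_radius (series \<epsilon>)"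
    unfolding fps_conv_radius_def
  proof (rule conv_radius_geI_ex')
    fix r :: real assume r: "0 < r" "ereal r < ereal \<rho>"
    \<comment> \<open>Abel's lemma needs a bound at a radius strictly beyond \<open>r\<close>; the
      midpoint of \<open>r\<close> and \<open>\<rho>\<close> serves.\<close>
    obtain C where C: "\<And>n. norm (fps_nth (series \<epsilon>) n) * ((r + \<rho>) / 2) ^ n \<le> C"
      using norm_series_bounded[of "(r + \<rho>) / 2" \<epsilon>] r by auto
    have "summable (\<lambda>n. norm (fps_nth (series \<epsilon>) n) * r ^ n)"
      using r C by (intro Abel_lemma[of r "(r + \<rho>) / 2"]) auto
    hence "summable (\<lambda>n. norm (fps_nth (series \<epsilon>) n * of_real r ^ n))"
      using r by (simp add: norm_mult norm_power)
    thus "summable (\<lambda>n. fps_nth (series \<epsilon>) n * of_real r ^ n)" by (rule summable_norm_cancel)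
  qed
qed

section \<open>Values of the block series\<close>

text \<open>Cutting the power series at \<open>t K\<close> leaves blocks 0 to \<open>K - 1\<close>
  complete, so the partial sums over blocks are a subsequence of the ordinary ones.\<close>

lemma eval_series_lim:
  assumes "z \<in> ball 0 \<rho>"
  shows "(\<lambda>K. \<Sum>k<K. digit \<epsilon> k * poly (block k) z) \<longlonglongrightarrow> eval_fps (series \<epsilon>) z"
proof -
  have "(\<lambda>n. fps_nth (series \<epsilon>) n * z ^ n) sums eval_fps (series \<epsilon>) z"
    using assms by (intro sums_eval_fps) (simp add: conv_radius_series)
  hence "(\<lambda>n. \<Sum>i<n. fps_nth (series \<epsilon>) i * z ^ i) \<longlonglongrightarrow> eval_fps (series \<epsilon>) z" by (simp add: sums_def)
  hence "(\<lambda>K. \<Sum>n<t K. fps_nth (series \<epsilon>) n * z ^ n) \<longlonglongrightarrow> eval_fps (series \<epsilon>) z"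
    using LIMSEQ_subseq_LIMSEQ[OF _ t_mono] by (force simp: o_def)
  moreover have "(\<Sum>n<t K. fps_nth (series \<epsilon>) n * z ^ n) = (\<Sum>k<K. digit \<epsilon> k * poly (block k) z)" for K
  proof -
    have "(\<Sum>n<t K. fps_nth (series \<epsilon>) n * z ^ n) = (\<Sum>n<t K. \<Sum>k<K. digit \<epsilon> k * (coeff (block k) n * z ^ n))"
      by (intro sum.cong refl) (simp add: series_nth[of _ K] sum_distrib_right mult.assoc)
    also have "\<dots> = (\<Sum>k<K. digit \<epsilon> k * (\<Sum>n<t K. coeff (block k) n * z ^ n))"
      by (subst sum.swap) (simp add: sum_distrib_left)
    also have "\<dots> = (\<Sum>k<K. digit \<epsilon> k * poly (block k) z)"
    proof (intro sum.cong refl arg_cong2[of _ _ _ _ "(*)"])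
      fix k assume "k \<in> {..<K}"
      hence "degree (block k) < t K" by (intro degree_block_less) simp
      hence "(\<Sum>n<t K. coeff (block k) n * z ^ n) = (\<Sum>n\<le>degree (block k). coeff (block k) n * z ^ n)"
        by (intro sum.mono_neutral_right) (auto intro: coeff_eq_0)
      thus "(\<Sum>n<t K. coeff (block k) n * z ^ n) = poly (block k) z" by (simp add: poly_altdef)
    qed
    finally show ?thesis .
  qed
  ultimately show ?thesis by simp
qed

text \<open>Only the blocks before \<open>K\<close> survive at \<open>z\<close>, so the value is
  that of an integer polynomial.\<close>

lemma algebraic_eval_series:
  assumes z: "z \<in> ball 0 \<rho>" "algebraic z" and zero: "\<And>k. k \<ge> K \<Longrightarrow> poly (Q k) z = 0"
  shows "algebraic (eval_fps (series \<epsilon>) z)"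
proof -
  define g where "g = (\<Sum>k<K. smult (digit \<epsilon> k) (block k))"
  have "(\<Sum>k<L. digit \<epsilon> k * poly (block k) z) = poly g z" if "L \<ge> K" for L
  proof -
    have "(\<Sum>k<L. digit \<epsilon> k * poly (block k) z) = (\<Sum>k<K. digit \<epsilon> k * poly (block k) z)"
      using that by (intro sum.mono_neutral_right) (auto simp: poly_block zero)
    thus ?thesis by (simp add: g_def poly_sum)
  qed
  hence "(\<lambda>L. \<Sum>k<L. digit \<epsilon> k * poly (block k) z) \<longlonglongrightarrow> poly g z"
    by (intro tendsto_eventually eventually_sequentiallyI)
  hence "eval_fps (series \<epsilon>) z = poly g z" using eval_series_lim[OF z(1)] LIMSEQ_unique by blast
  moreover have "coeff g i \<in> \<int>" for i
    by (auto simp: g_def coeff_sum intro!: Ints_sum Ints_mult coeff_block_int)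
  ultimately show ?thesis using algebraic_poly_value[OF z(2)] by simp
qed

text \<open>At the first index \<open>k\<close> where the digits differ, the difference of the two
  series has a term of norm \<open>norm (b k)\<close>. The later terms add up to at most 1/3 + 1/9 +
  ... = 1/2 of it, so the values cannot agree. \<open>init\<close> forces \<open>k \<ge> i\<close>,
  where the decay is available.\<close>

lemma eval_series_eq_imp_eq:
  assumes z: "z \<in> ball 0 \<rho>"
    and nz: "\<And>k. k \<ge> i \<Longrightarrow> poly (block k) z \<noteq> 0"
    and decay: "\<And>k. k \<ge> i \<Longrightarrow> norm (poly (block (Suc k)) z) \<le> norm (poly (block k) z) / 3"
    and eq: "eval_fps (series \<epsilon>) z = eval_fps (series \<epsilon>') z"
    and init: "\<And>k. k < i \<Longrightarrow> \<epsilon> k = \<epsilon>' k"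
  shows "\<epsilon> = \<epsilon>'"
proof (rule ccontr)
  assume "\<epsilon> \<noteq> \<epsilon>'"
  define k where "k = (LEAST k. \<epsilon> k \<noteq> \<epsilon>' k)"
  have "\<exists>k. \<epsilon> k \<noteq> \<epsilon>' k" using \<open>\<epsilon> \<noteq> \<epsilon>'\<close> by auto
  hence k: "\<epsilon> k \<noteq> \<epsilon>' k" "\<And>j. j < k \<Longrightarrow> \<epsilon> j = \<epsilon>' j"
    unfolding k_def by (rule LeastI_ex, use not_less_Least in blast)
  have ki: "k \<ge> i" using k(1) init by (meson not_le)
  define b where "b j = poly (block j) z" for j
  define d where "d j = digit \<epsilon> j - digit \<epsilon>' j" for j
  have d: "norm (d j) \<le> 1" "norm (d k) = 1" "j < k \<Longrightarrow> d j = 0" for j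
    using k by (auto simp: d_def digit_def)
  have b_decay: "norm (b (k + m)) \<le> norm (b k) * (1 / 3) ^ m" for m
  proof (induction m)
    case (Suc m)
    have "norm (b (Suc (k + m))) \<le> norm (b (k + m)) / 3"
      unfolding b_def using ki by (intro decay) simp
    thus ?case using Suc by simp
  qed simp
  have partial: "norm (b k) / 2 \<le> norm (\<Sum>j<Suc k + L. d j * b j)" for L
  proof -
    have "(\<Sum>j<Suc k + L. d j * b j) = (\<Sum>j<Suc k. d j * b j) + (\<Sum>m<L. d (Suc k + m) * b (Suc k + m))"
      by (induction L) (simp_all add: add.assoc)
    also have "(\<Sum>j<Suc k. d j * b j) = d k * b k" using d(3) by simp
    finally have split: "(\<Sum>j<Suc k + L. d j * b j) = d k * b k + (\<Sum>m<L. d (Suc k + m) * b (Suc k + m))" .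
    have "norm (\<Sum>m<L. d (Suc k + m) * b (Suc k + m)) \<le> (\<Sum>m<L. norm (b k) * (1 / 3) * (1 / 3) ^ m)"
    proof (rule sum_norm_le)
      fix m
      have "norm (d (Suc k + m) * b (Suc k + m)) \<le> 1 * norm (b (k + Suc m))"
        unfolding norm_mult using d(1) by (intro mult_mono) auto
      also have "\<dots> \<le> norm (b k) * (1 / 3) ^ Suc m" using b_decay[of "Suc m"] by simp
      finally show "norm (d (Suc k + m) * b (Suc k + m)) \<le> norm (b k) * (1 / 3) * (1 / 3) ^ m" by simp
    qed
    also have "\<dots> = norm (b k) * (1 / 3) * (\<Sum>m<L. (1 / 3) ^ m)" by (simp add: sum_distrib_left)
    also have "(\<Sum>m<L. (1 / 3 :: real) ^ m) \<le> 3 / 2"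
      by (subst sum_gp_strict) (simp add: field_simps)
    finally have "norm (\<Sum>m<L. d (Suc k + m) * b (Suc k + m)) \<le> norm (b k) / 2"
      by (simp add: mult_left_mono)
    moreover have "norm (d k * b k) = norm (b k)" using d(2) by (simp add: norm_mult)
    ultimately show ?thesis unfolding split
      using norm_diff_ineq[of "d k * b k" "\<Sum>m<L. d (Suc k + m) * b (Suc k + m)"] by linarith
  qed
  have "(\<lambda>K. (\<Sum>j<K. digit \<epsilon> j * poly (block j) z) - (\<Sum>j<K. digit \<epsilon>' j * poly (block j) z)) \<longlonglongrightarrow> 0"
    using tendsto_diff[OF eval_series_lim[OF z, of \<epsilon>] eval_series_lim[OF z, of \<epsilon>']] eq by simp
  hence "(\<lambda>K. \<Sum>j<K. d j * b j) \<longlonglongrightarrow> 0"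
    by (simp add: d_def b_def left_diff_distrib sum_subtractf)
  hence "(\<lambda>L. \<Sum>j<L + Suc k. d j * b j) \<longlonglongrightarrow> 0" by (rule LIMSEQ_ignore_initial_segment)
  hence "(\<lambda>L. norm (\<Sum>j<Suc k + L. d j * b j)) \<longlonglongrightarrow> 0"
    by (simp add: tendsto_norm_zero_iff add.commute)
  hence "norm (b k) / 2 \<le> 0" by (rule Lim_bounded2) (use partial in auto)
  thus False using nz[OF ki] by (simp add: b_def)
qed

text \<open>Within a fibre the first \<open>i\<close> digits determine the whole sequence, and there
  are only countably many finite prefixes.\<close>

lemma countable_eval_series_fibre:
  assumes "z \<in> ball 0 \<rho>" "\<And>k. k \<ge> i \<Longrightarrow> poly (block k) z \<noteq> 0"
    "\<And>k. k \<ge> i \<Longrightarrow> norm (poly (block (Suc k)) z) \<le> norm (poly (block k) z) / 3"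
  shows "countable {\<epsilon>. eval_fps (series \<epsilon>) z = w}"
proof (rule countableI')
  show "inj_on (\<lambda>\<epsilon>. to_nat (map \<epsilon> [0..<i])) {\<epsilon>. eval_fps (series \<epsilon>) z = w}"
    by (rule inj_onI) (auto intro!: eval_series_eq_imp_eq[OF assms])
qed

end

section \<open>Choice of the blocks\<close>

lemma uncountable_nat_bool: "uncountable (UNIV :: (nat \<Rightarrow> bool) set)"
proof
  assume "countable (UNIV :: (nat \<Rightarrow> bool) set)"
  then obtain g :: "nat \<Rightarrow> nat \<Rightarrow> bool" where "range g = UNIV"
    using uncountable_def by blast
  then obtain n where "g n = (\<lambda>k. \<not> g k k)" by (metis surjD)
  hence "g n n = (\<not> g n n)" by (rule fun_cong)
  thus False by simp
qed

lemma coeff_prod_Ints: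
  fixes p :: "'i \<Rightarrow> 'a::comm_ring_1 poly"
  assumes "\<And>i n. i \<in> I \<Longrightarrow> coeff (p i) n \<in> \<int>"
  shows "coeff (\<Prod>i\<in>I. p i) n \<in> \<int>"
  using assms
proof (induction I arbitrary: n rule: infinite_finite_induct)
  case (insert i I)
  thus ?case by (auto simp: coeff_mult intro!: Ints_sum Ints_mult)
qed auto

text \<open>Each new element of the enumeration adds a factor, so every nonzero point of
  \<open>S\<close> is eventually a root for good. A root of \<open>Q k\<close> in the disc is
  conjugate to an element of \<open>S\<close> and thus lies in \<open>S\<close>; this is where
  closedness enters.\<close>

lemma closed_rel_algebraic_polys:
  assumes S: "S \<subseteq> {\<alpha>. algebraic \<alpha>} \<inter> ball 0 \<rho>" "closed_rel_algebraic \<rho> S" "S \<noteq> {}"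
  obtains Q :: "nat \<Rightarrow> complex poly" where
    "\<And>k i. coeff (Q k) i \<in> \<int>" "\<And>k. coeff (Q k) 0 \<noteq> 0"
    "\<And>\<alpha>. \<alpha> \<in> S \<Longrightarrow> \<alpha> \<noteq> 0 \<Longrightarrow> \<exists>K. \<forall>k\<ge>K. poly (Q k) \<alpha> = 0"
    "\<And>k \<alpha>. \<alpha> \<in> ball 0 \<rho> - S \<Longrightarrow> poly (Q k) \<alpha> \<noteq> 0"
proof -
  have "countable S" using S(1) by (intro countable_subset[OF _ countable_algebraic]) auto
  define s where "s = from_nat_into S"
  have s: "range s = S" unfolding s_def using S(3) \<open>countable S\<close> by (rule range_from_nat_into)
  have "\<forall>\<alpha>\<in>S - {0}. \<exists>m. (\<forall>i. coeff m i \<in> \<int>) \<and> poly m \<alpha> = 0 \<and> poly m 0 \<noteq> 0 \<and>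
          (\<forall>\<beta>. poly m \<beta> = 0 \<longrightarrow> \<beta> \<in> conjugates \<alpha>)"
  proof
    fix \<alpha> assume \<alpha>: "\<alpha> \<in> S - {0}"
    hence "algebraic \<alpha>" using S(1) by auto
    then obtain m :: "complex poly" where "\<And>i. coeff m i \<in> \<int>" "m \<noteq> 0" "poly m \<alpha> = 0"
      "\<And>\<beta>. poly m \<beta> = 0 \<Longrightarrow> \<beta> \<in> conjugates \<alpha>" "\<alpha> \<noteq> 0 \<Longrightarrow> poly m 0 \<noteq> 0"
      using conjugates_int_poly by blast
    thus "\<exists>m. (\<forall>i. coeff m i \<in> \<int>) \<and> poly m \<alpha> = 0 \<and> poly m 0 \<noteq> 0 \<and>
            (\<forall>\<beta>. poly m \<beta> = 0 \<longrightarrow> \<beta> \<in> conjugates \<alpha>)" using \<alpha> by blast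
  qed
  from bchoice[OF this] obtain m where
    "\<forall>\<alpha>\<in>S - {0}. (\<forall>i. coeff (m \<alpha>) i \<in> \<int>) \<and> poly (m \<alpha>) \<alpha> = 0 \<and> poly (m \<alpha>) 0 \<noteq> 0 \<and>
       (\<forall>\<beta>. poly (m \<alpha>) \<beta> = 0 \<longrightarrow> \<beta> \<in> conjugates \<alpha>)" ..
  hence m: "\<And>\<alpha> i. \<alpha> \<in> S \<Longrightarrow> \<alpha> \<noteq> 0 \<Longrightarrow> coeff (m \<alpha>) i \<in> \<int>"
    "\<And>\<alpha>. \<alpha> \<in> S \<Longrightarrow> \<alpha> \<noteq> 0 \<Longrightarrow> poly (m \<alpha>) \<alpha> = 0" "\<And>\<alpha>. \<alpha> \<in> S \<Longrightarrow> \<alpha> \<noteq> 0 \<Longrightarrow> poly (m \<alpha>) 0 \<noteq> 0"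
    "\<And>\<alpha> \<beta>. \<alpha> \<in> S \<Longrightarrow> \<alpha> \<noteq> 0 \<Longrightarrow> poly (m \<alpha>) \<beta> = 0 \<Longrightarrow> \<beta> \<in> conjugates \<alpha>" by auto
  \<comment> \<open>The point 0 contributes the factor 1, which keeps the constant term of the
    product nonzero.\<close>
  define q where "q i = (if s i = 0 then 1 else m (s i))" for i
  define Q where "Q k = (\<Prod>i<k. q i)" for k
  have sS: "s i \<in> S" for i using s by auto
  show ?thesis
  proof (rule that[of Q])
    show "coeff (Q k) i \<in> \<int>" for k i
      unfolding Q_def by (rule coeff_prod_Ints) (use m(1)[OF sS] in \<open>auto simp: q_def\<close>)
    have "poly (Q k) 0 \<noteq> 0" for k
      using m(3)[OF sS] by (auto simp: Q_def q_def poly_prod)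
    thus "coeff (Q k) 0 \<noteq> 0" for k by (simp add: poly_0_coeff_0)
  next
    fix \<alpha> assume "\<alpha> \<in> S" "\<alpha> \<noteq> 0"
    moreover obtain i where "s i = \<alpha>" using s \<open>\<alpha> \<in> S\<close> by blast
    ultimately have "poly (q i) \<alpha> = 0" by (simp add: q_def m(2))
    hence "poly (Q k) \<alpha> = 0" if "k \<ge> Suc i" for k
      using that by (auto simp: Q_def poly_prod)
    thus "\<exists>K. \<forall>k\<ge>K. poly (Q k) \<alpha> = 0" by blast
  next
    fix k \<alpha> assume \<alpha>: "\<alpha> \<in> ball 0 \<rho> - S"
    show "poly (Q k) \<alpha> \<noteq> 0"
    proof
      assume "poly (Q k) \<alpha> = 0"
      then obtain i where i: "poly (q i) \<alpha> = 0" by (auto simp: Q_def poly_prod)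
      hence "s i \<noteq> 0" by (auto simp: q_def)
      hence "\<alpha> \<in> conjugates (s i)" using i m(4)[OF sS] by (simp add: q_def)
      hence "\<alpha> \<in> alg_hull S" using sS by (auto simp: alg_hull_def)
      thus False using \<alpha> S(2) unfolding closed_rel_algebraic_def by blast
    qed
  qed
qed

text \<open>The terms are dominated by a geometric sequence of ratio
  \<open>norm z / \<rho> < 1\<close>. This lets a later exponent make the next block as small as
  desired at a given point.\<close>

lemma floor_power_mult_tendsto_0:
  fixes z :: complex
  assumes "0 < \<rho>" "z \<in> ball 0 \<rho>"
  shows "(\<lambda>n. of_int \<lfloor>(1 / \<rho>) ^ n\<rfloor> * z ^ n * w) \<longlonglongrightarrow> 0"
proof (rule Lim_null_comparison)
  show "(\<lambda>n. (norm z / \<rho>) ^ n * norm w) \<longlonglongrightarrow> 0"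
    using assms by (intro tendsto_mult_left_zero LIMSEQ_power_zero) auto
  show "eventually (\<lambda>n. norm (of_int \<lfloor>(1 / \<rho>) ^ n\<rfloor> * z ^ n * w) \<le> (norm z / \<rho>) ^ n * norm w) sequentially"
  proof (intro always_eventually allI)
    fix n
    have "0 \<le> \<lfloor>(1 / \<rho>) ^ n\<rfloor>" using assms(1) by simp
    hence "norm (of_int \<lfloor>(1 / \<rho>) ^ n\<rfloor> :: complex) \<le> (1 / \<rho>) ^ n" by simp
    hence "norm (of_int \<lfloor>(1 / \<rho>) ^ n\<rfloor> :: complex) * norm z ^ n * norm w \<le> (1 / \<rho>) ^ n * norm z ^ n * norm w"
      by (intro mult_right_mono) auto
    thus "norm (of_int \<lfloor>(1 / \<rho>) ^ n\<rfloor> * z ^ n * w) \<le> (norm z / \<rho>) ^ n * norm w"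
      by (simp add: norm_mult norm_power power_divide)
  qed
qed

theorem theorem1p6:
  fixes \<rho> :: real and S :: "complex set"
  assumes "0 < \<rho>" and "\<rho> \<le> 1"
    and "S \<subseteq> {\<alpha>. algebraic \<alpha>} \<inter> ball 0 \<rho>"
    and "closed_rel_algebraic \<rho> S"
    and "0 \<in> S"
  shows "uncountable {f :: complex fps.
           transcendental_fps f \<and> (\<forall>n. fps_nth f n \<in> \<int>) \<and>
           exceptional_set f = S \<and>
           fps_conv_radius f = ereal \<rho> \<and>
           has_natural_density (zero_coeffs f) 1}"
proof -
  obtain Q :: "nat \<Rightarrow> complex poly" where Q: "\<And>k i. coeff (Q k) i \<in> \<int>" "\<And>k. coeff (Q k) 0 \<noteq> 0"
    "\<And>\<alpha>. \<alpha> \<in> S \<Longrightarrow> \<alpha> \<noteq> 0 \<Longrightarrow> \<exists>K. \<forall>k\<ge>K. poly (Q k) \<alpha> = 0"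
    "\<And>k \<alpha>. \<alpha> \<in> ball 0 \<rho> - S \<Longrightarrow> poly (Q k) \<alpha> \<noteq> 0"
    using closed_rel_algebraic_polys[of S \<rho>] assms by blast
  define A where "A = {\<alpha>. algebraic \<alpha>} \<inter> ball 0 \<rho> - S"
  have "countable A"
    unfolding A_def by (rule countable_subset[OF _ countable_algebraic]) auto
  define a where "a = from_nat_into A"
  \<comment> \<open>The value of block \<open>k\<close> if its exponent were \<open>n\<close>,
    available before \<open>t\<close> is chosen.\<close>
  define b where "b k n z = of_int \<lfloor>(1 / \<rho>) ^ n\<rfloor> * z ^ n * poly (Q k) z" for k n and z :: complex
  have b_nz: "b k n z \<noteq> 0" if "z \<in> A" for k n z
  proof -
    have "1 \<le> (1 / \<rho>) ^ n" using assms(1,2) by (intro one_le_power) simp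
    hence "\<lfloor>(1 / \<rho>) ^ n\<rfloor> \<noteq> 0" by linarith
    \<comment> \<open>0 belongs to \<open>S\<close> and hence not to \<open>A\<close>, so no power
      of \<open>z\<close> vanishes.\<close>
    moreover have "z \<noteq> 0" "poly (Q k) z \<noteq> 0" using that assms(5) Q(4) by (auto simp: A_def)
    ultimately show ?thesis by (simp add: b_def)
  qed
  define small where "small k n \<longleftrightarrow>
      (real (k + 1) / real (k + 2)) ^ n * (\<Sum>i\<le>degree (Q k). norm (coeff (Q k) i)) \<le> 1 \<and>
      k * (\<Sum>j\<le>k. degree (Q j) + 1) \<le> n" for k n
  \<comment> \<open>Decay is demanded only at the first \<open>k + 1\<close> points of the
    enumeration, so each exponent meets finitely many conditions, yet every point of
    \<open>A\<close> gets decay from its own index on. The guard \<open>a i \<in> A\<close> covers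
    an empty \<open>A\<close>, where \<open>a\<close> is arbitrary.\<close>
  define next_ok where "next_ok k m n \<longleftrightarrow> Suc k * (m + degree (Q k)) + k < n \<and>
      (\<forall>i\<le>k. a i \<in> A \<longrightarrow> norm (b (Suc k) n (a i)) \<le> norm (b k m (a i)) / 3)" for k m n
  have small: "eventually (small k) sequentially" for k
  proof -
    have "(\<lambda>n. (real (k + 1) / real (k + 2)) ^ n * (\<Sum>i\<le>degree (Q k). norm (coeff (Q k) i))) \<longlonglongrightarrow> 0"
      by (intro tendsto_mult_left_zero LIMSEQ_power_zero) simp
    hence "eventually (\<lambda>n. (real (k + 1) / real (k + 2)) ^ n
             * (\<Sum>i\<le>degree (Q k). norm (coeff (Q k) i)) < 1) sequentially"
      by (rule order_tendstoD) simp
    hence "eventually (\<lambda>n. (real (k + 1) / real (k + 2)) ^ n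
             * (\<Sum>i\<le>degree (Q k). norm (coeff (Q k) i)) \<le> 1) sequentially"
      by eventually_elim simp
    thus ?thesis
      unfolding small_def by (intro eventually_conj eventually_ge_at_top)
  qed
  have next_ok: "eventually (next_ok k m) sequentially" for k m
  proof -
    have "eventually (\<lambda>n. a i \<in> A \<longrightarrow> norm (b (Suc k) n (a i)) \<le> norm (b k m (a i)) / 3) sequentially" for i
    proof (cases "a i \<in> A")
      case True
      have "(\<lambda>n. norm (b (Suc k) n (a i))) \<longlonglongrightarrow> 0"
        unfolding b_def using True assms(1)
        by (intro tendsto_norm_zero floor_power_mult_tendsto_0) (auto simp: A_def)
      moreover have "0 < norm (b k m (a i)) / 3" using b_nz[OF True] by simp
      ultimately have "eventually (\<lambda>n. norm (b (Suc k) n (a i)) < norm (b k m (a i)) / 3) sequentially"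
        by (rule order_tendstoD)
      thus ?thesis by eventually_elim simp
    qed simp
    hence "eventually (\<lambda>n. \<forall>i\<in>{..k}. a i \<in> A \<longrightarrow> norm (b (Suc k) n (a i)) \<le> norm (b k m (a i)) / 3) sequentially"
      by (intro eventually_ball_finite) auto
    hence "eventually (\<lambda>n. \<forall>i\<le>k. a i \<in> A \<longrightarrow> norm (b (Suc k) n (a i)) \<le> norm (b k m (a i)) / 3) sequentially"
      by (simp only: Ball_def atMost_iff)
    thus ?thesis
      unfolding next_ok_def by (intro eventually_conj eventually_gt_at_top)
  qed
  obtain t where t: "strict_mono t" "\<And>k. small k (t k)" "\<And>k. next_ok k (t k) (t (Suc k))"
    using exists_fast_growing_sequence[of small next_ok, OF small next_ok] by blast
  interpret block_series \<rho> Q t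
  proof
    show "Suc k * (t k + degree (Q k)) + k < t (Suc k)" for k
      using t(3)[of k] unfolding next_ok_def by blast
    show "(real (k + 1) / real (k + 2)) ^ t k * (\<Sum>i\<le>degree (Q k). norm (coeff (Q k) i)) \<le> 1"
      "k * (\<Sum>j\<le>k. degree (Q j) + 1) \<le> t k" for k
      using t(2)[of k] unfolding small_def by blast+
  qed (fact assms Q t)+
  have block_b: "poly (block k) z = b k (t k) z" for k z
    by (simp add: poly_block b_def scale_def)
  have fibre: "countable {\<epsilon>. eval_fps (series \<epsilon>) z = w}" if z: "z \<in> A" for z w
  proof -
    have "z \<in> range a"
      unfolding a_def using z \<open>countable A\<close> by (subst range_from_nat_into) auto
    then obtain i where i: "a i = z" by blast
    show ?thesis
    proof (rule countable_eval_series_fibre[of z i])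
      show "z \<in> ball 0 \<rho>" using z by (simp add: A_def)
      show "poly (block k) z \<noteq> 0" for k using b_nz[OF z] by (simp add: block_b)
      show "norm (poly (block (Suc k)) z) \<le> norm (poly (block k) z) / 3" if "i \<le> k" for k
        using t(3)[of k] that z i unfolding next_ok_def block_b by blast
    qed
  qed
  \<comment> \<open>The digit sequences taking an algebraic value at some point of \<open>A\<close>:
    a countable union of countable fibres.\<close>
  define bad where "bad = (\<Union>z\<in>A. \<Union>w\<in>{w. algebraic w}. {\<epsilon>. eval_fps (series \<epsilon>) z = w})"
  have "countable bad"
    unfolding bad_def by (intro countable_UN \<open>countable A\<close> countable_algebraic fibre)
  hence "uncountable (UNIV - bad)" using uncountable_nat_bool by (rule uncountable_minus_countable[rotated])
  hence unc: "uncountable (series ` (UNIV - bad))"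
    using inj_series by (metis countable_image_inj_on inj_on_subset subset_UNIV)
  have exc: "exceptional_set (series \<epsilon>) = S" if \<epsilon>: "\<epsilon> \<notin> bad" for \<epsilon>
  proof
    show "exceptional_set (series \<epsilon>) \<subseteq> S"
    proof
      fix \<alpha> assume "\<alpha> \<in> exceptional_set (series \<epsilon>)"
      hence \<alpha>: "\<alpha> \<in> ball 0 \<rho>" "algebraic \<alpha>" "algebraic (eval_fps (series \<epsilon>) \<alpha>)"
        by (simp_all add: exceptional_set_def conv_radius_series)
      show "\<alpha> \<in> S"
      proof (rule ccontr)
        assume "\<alpha> \<notin> S"
        hence "\<alpha> \<in> A" using \<alpha> by (simp add: A_def)
        hence "\<epsilon> \<in> bad" using \<alpha>(3) unfolding bad_def by blast
        thus False using \<epsilon> by simp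
      qed
    qed
    show "S \<subseteq> exceptional_set (series \<epsilon>)"
    proof
      fix \<alpha> assume \<alpha>: "\<alpha> \<in> S"
      hence \<alpha>': "\<alpha> \<in> ball 0 \<rho>" "algebraic \<alpha>" using assms(3) by auto
      have "algebraic (eval_fps (series \<epsilon>) \<alpha>)"
      proof (cases "\<alpha> = 0")
        \<comment> \<open>No \<open>Q k\<close> vanishes at 0, so the series does not terminate by
          blocks there; its value is the integer constant coefficient.\<close>
        case True
        have "fps_nth (series \<epsilon>) 0 \<in> \<rat>" using series_int[of \<epsilon> 0] by (auto elim!: Ints_cases)
        thus ?thesis using True by (simp add: eval_fps_at_0 rat_imp_algebraic)
      next
        case False
        then obtain K where "\<forall>k\<ge>K. poly (Q k) \<alpha> = 0" using Q(3) \<alpha> by blast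
        thus ?thesis using \<alpha>' by (intro algebraic_eval_series[of \<alpha> K]) simp_all
      qed
      thus "\<alpha> \<in> exceptional_set (series \<epsilon>)"
        using \<alpha>' by (simp add: exceptional_set_def conv_radius_series)
    qed
  qed
  have "series ` (UNIV - bad) \<subseteq> {f. transcendental_fps f \<and> (\<forall>n. fps_nth f n \<in> \<int>) \<and>
      exceptional_set f = S \<and> fps_conv_radius f = ereal \<rho> \<and> has_natural_density (zero_coeffs f) 1}"
    using exc transcendental_series series_int conv_radius_series density_series by blast
  thus ?thesis using unc countable_subset by blast
qed

end
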